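(* Let $K$ be a differential field with derivation $\partial$ and let $\mathcal{L},\mathcal{R},\mathcal{S}$ be linear differential operators over $K$, each with nonzero order-zero coefficient. Then: 1. $\widetilde{\mathcal{L}}\diamond\widetilde{\mathcal{R}}=\widetilde{\mathcal{R}\diamond\mathcal{L}}$. 2. $(\mathcal{L}\diamond\mathcal{R})\diamond\mathcal{S}=\mathcal{L}\diamond(\mathcal{R}\diamond\mathcal{S})$.
   Context: A linear differential operator over a differential field $K$ is an element of the ring $K[\partial]$ (where $\partial a=a\partial+\partial(a)$ for $a\in K$); only operators $\mathcal{L}=\sum_{k=0}^{n}a_{n-k}\partial^{n-k}$ with $a_i\in K$ and $a_0\neq0$ are considered. If $\mathcal{L}$ has order $n$, then $C(\mathcal{L})=n+1$ is its number of coefficients, and its Reversing is $\widetilde{\mathcal{L}}=\sum_{k=0}^{n}b_{n-k}\partial^{n-k}$ with $b_{n-k}=a_k$ for $k=0,\dots,n$. The Pasting of $\mathcal{L}$ and $\mathcal{R}$ is $\mathcal{L}\diamond\mathcal{R}=\mathcal{L}\,\partial^{C(\mathcal{R})}+\mathcal{R}$. *)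

theory Defs
  imports "HOL-Computational_Algebra.Polynomial"
begin

class differential_field = field +
  fixes der :: "'a \<Rightarrow> 'a"
  assumes der_add: "der (a + b) = der a + der b"
    and der_mult: "der (a * b) = der a * b + a * der b"
begin

lemma der_0 [simp]: "der 0 = 0"
  using der_add [of 0 0] by simp

lemma der_1 [simp]: "der 1 = 0"
  using der_mult [of 1 1] by simp

end

text \<open>
  The skew polynomial ring \<open>K[\<partial>]\<close>.  As a left \<open>K\<close>-vector space it is a copy of the polynomials
  over \<open>K\<close>, the polynomial with coefficients \<open>a\<^sub>i\<close> standing for \<open>\<Sum>i. a\<^sub>i \<partial>\<^sup>i\<close> (coefficients
  on the left); only the multiplication differs.
\<close>

typedef (overloaded) 'a diffop = "UNIV :: 'a::zero poly set"
  morphisms poly_of_diffop Diffop ..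

setup_lifting type_definition_diffop

text \<open>
  Left multiplication by \<open>\<partial>\<close>, that is
  \<open>\<partial> (\<Sum>i. a\<^sub>i \<partial>\<^sup>i) = \<Sum>i. a\<^sub>i \<partial>\<^bsup>i+1\<^esup> + \<Sum>i. der a\<^sub>i \<partial>\<^sup>i\<close>.
\<close>

definition partial_mult :: "'a::differential_field poly \<Rightarrow> 'a poly" where
  "partial_mult q = pCons 0 q + map_poly der q"

definition skew_mult :: "'a::differential_field poly \<Rightarrow> 'a poly \<Rightarrow> 'a poly" where
  "skew_mult p q = (\<Sum>i\<le>degree p. smult (coeff p i) ((partial_mult ^^ i) q))"

lemma partial_mult_0 [simp]: "partial_mult 0 = 0"
  by (simp add: partial_mult_def)

lemma partial_mult_add: "partial_mult (p + q) = partial_mult p + partial_mult q"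
  by (rule poly_eqI) (simp add: partial_mult_def coeff_map_poly coeff_pCons der_add split: nat.split)

lemma partial_mult_smult:
  "partial_mult (smult a p) = smult a (partial_mult p) + smult (der a) p"
  by (rule poly_eqI)
     (simp add: partial_mult_def coeff_map_poly coeff_pCons der_mult algebra_simps split: nat.split)

lemma partial_mult_sum: "partial_mult (sum f A) = (\<Sum>i\<in>A. partial_mult (f i))"
  by (induction A rule: infinite_finite_induct) (simp_all add: partial_mult_add)

lemma partial_mult_pow_add:
  "(partial_mult ^^ i) (p + q) = (partial_mult ^^ i) p + (partial_mult ^^ i) q"
  by (induction i) (simp_all add: partial_mult_add)

lemma partial_mult_pow_0 [simp]: "(partial_mult ^^ i) 0 = 0"
  by (induction i) simp_all

lemma partial_mult_pow_1: "(partial_mult ^^ i) 1 = monom 1 i"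
proof (induction i)
  case (Suc i)
  have "partial_mult (monom 1 i :: 'a poly) = monom 1 (Suc i)"
    by (rule poly_eqI) (simp add: partial_mult_def coeff_map_poly coeff_pCons split: nat.split)
  with Suc show ?case by simp
qed (simp add: monom_0 one_pCons)

lemma skew_mult_bound:
  assumes "degree p \<le> n"
  shows "skew_mult p q = (\<Sum>i\<le>n. smult (coeff p i) ((partial_mult ^^ i) q))"
  unfolding skew_mult_def
  by (rule sum.mono_neutral_left) (use assms in \<open>auto simp: coeff_eq_0\<close>)

lemma skew_mult_add_left: "skew_mult (p + q) r = skew_mult p r + skew_mult q r"
proof -
  define n where "n = max (degree p) (degree q)"
  have "degree (p + q) \<le> n" "degree p \<le> n" "degree q \<le> n"
    by (simp_all add: n_def degree_add_le_max)
  then show ?thesis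
    by (simp add: skew_mult_bound smult_add_left sum.distrib)
qed

lemma skew_mult_add_right: "skew_mult p (q + r) = skew_mult p q + skew_mult p r"
  by (simp add: skew_mult_def partial_mult_pow_add smult_add_right sum.distrib)

lemma skew_mult_0_left [simp]: "skew_mult 0 q = 0"
  by (simp add: skew_mult_def)

lemma smult_sum_right: "smult a (sum f A) = (\<Sum>i\<in>A. smult a (f i :: 'a::comm_semiring_0 poly))"
  by (induction A rule: infinite_finite_induct) (simp_all add: smult_add_right)

lemma skew_mult_smult_left: "skew_mult (smult a p) q = smult a (skew_mult p q)"
proof -
  have "degree (smult a p) \<le> degree p" by (rule degree_smult_le)
  then have "skew_mult (smult a p) q =
      (\<Sum>i\<le>degree p. smult (coeff (smult a p) i) ((partial_mult ^^ i) q))"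
    by (rule skew_mult_bound)
  then show ?thesis
    by (simp add: skew_mult_def smult_sum_right)
qed

lemma skew_mult_sum_left: "skew_mult (sum f A) q = (\<Sum>i\<in>A. skew_mult (f i) q)"
  by (induction A rule: infinite_finite_induct) (simp_all add: skew_mult_add_left)

lemma skew_mult_partial_left: "skew_mult (partial_mult p) q = partial_mult (skew_mult p q)"
proof -
  define n where "n = degree p"
  have deg_map: "degree (map_poly der p) \<le> n"
    unfolding n_def by (rule degree_le) (simp add: coeff_map_poly coeff_eq_0)
  have deg_shift: "degree (pCons 0 p) \<le> Suc n"
    by (simp add: n_def degree_pCons_le)
  have "skew_mult (partial_mult p) q = skew_mult (pCons 0 p) q + skew_mult (map_poly der p) q"
    by (simp add: partial_mult_def skew_mult_add_left)
  also have "skew_mult (pCons 0 p) q =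
      (\<Sum>i\<le>n. smult (coeff p i) (partial_mult ((partial_mult ^^ i) q)))"
    by (simp add: skew_mult_bound [OF deg_shift] sum.atMost_Suc_shift del: sum.atMost_Suc)
  also have "skew_mult (map_poly der p) q =
      (\<Sum>i\<le>n. smult (der (coeff p i)) ((partial_mult ^^ i) q))"
    by (simp add: skew_mult_bound [OF deg_map] coeff_map_poly)
  finally show ?thesis
    by (simp add: skew_mult_def partial_mult_sum partial_mult_smult sum.distrib n_def)
qed

lemma skew_mult_partial_pow_left:
  "skew_mult ((partial_mult ^^ i) p) q = (partial_mult ^^ i) (skew_mult p q)"
  by (induction i) (simp_all add: skew_mult_partial_left)

lemma skew_mult_assoc: "skew_mult (skew_mult p q) r = skew_mult p (skew_mult q r)"
  by (subst (2) skew_mult_def)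
     (simp add: skew_mult_sum_left skew_mult_smult_left skew_mult_partial_pow_left
        skew_mult_def [of p])

lemma skew_mult_1_left: "skew_mult 1 q = q"
  by (simp add: skew_mult_def)

lemma skew_mult_1_right: "skew_mult p 1 = p"
  by (simp add: skew_mult_def partial_mult_pow_1 smult_monom poly_as_sum_of_monoms)

instantiation diffop :: (differential_field) ring_1
begin

lift_definition zero_diffop :: "'a diffop" is "0" .
lift_definition one_diffop :: "'a diffop" is "1" .
lift_definition plus_diffop :: "'a diffop \<Rightarrow> 'a diffop \<Rightarrow> 'a diffop" is "(+)" .
lift_definition minus_diffop :: "'a diffop \<Rightarrow> 'a diffop \<Rightarrow> 'a diffop" is "(-)" .
lift_definition uminus_diffop :: "'a diffop \<Rightarrow> 'a diffop" is "uminus" .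
lift_definition times_diffop :: "'a diffop \<Rightarrow> 'a diffop \<Rightarrow> 'a diffop" is skew_mult .

instance
  by standard
     (transfer; simp add: algebra_simps skew_mult_assoc skew_mult_1_left skew_mult_1_right
        skew_mult_add_left skew_mult_add_right)+

end

lift_definition diffop_const :: "'a::differential_field \<Rightarrow> 'a diffop" is "\<lambda>a. [:a:]" .

lift_definition diffop_partial :: "'a::differential_field diffop" (\<open>\<partial>\<close>) is "[:0, 1:]" .

lift_definition diffop_coeff :: "'a::differential_field diffop \<Rightarrow> nat \<Rightarrow> 'a" is coeff .

lift_definition diffop_order :: "'a::differential_field diffop \<Rightarrow> nat" is degree .

lemma diffop_const_add: "diffop_const (a + b) = diffop_const a + diffop_const b"
  by transfer simp

lemma diffop_const_mult: "diffop_const (a * b) = diffop_const a * diffop_const b"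
  by transfer (simp add: skew_mult_def)

lemma diffop_const_0 [simp]: "diffop_const 0 = 0"
  by transfer simp

lemma diffop_const_1 [simp]: "diffop_const 1 = 1"
  by transfer (simp add: one_pCons)

lemma diffop_partial_const:
  "\<partial> * diffop_const a = diffop_const a * \<partial> + diffop_const (der a)"
  by transfer (simp add: skew_mult_def partial_mult_def map_poly_pCons)

lemma diffop_const_inject: "diffop_const a = diffop_const b \<longleftrightarrow> a = b"
  by transfer simp

lemma diffop_eqI: "(\<And>i. diffop_coeff L i = diffop_coeff R i) \<Longrightarrow> L = R"
  by transfer (rule poly_eqI)

lemma diffop_coeff_add [simp]:
  "diffop_coeff (L + R) i = diffop_coeff L i + diffop_coeff R i"
  by transfer simp

lemma diffop_coeff_0 [simp]: "diffop_coeff 0 i = 0"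
  by transfer simp

lemma diffop_coeff_sum: "diffop_coeff (sum f A) i = (\<Sum>k\<in>A. diffop_coeff (f k) i)"
  by (induction A rule: infinite_finite_induct) simp_all

lemma poly_of_diffop_partial_power: "poly_of_diffop (\<partial> ^ k) = monom 1 k"
proof (induction k)
  case (Suc k)
  have "skew_mult [:0, 1:] (monom 1 k :: 'a poly) = monom 1 (Suc k)"
    by (simp add: skew_mult_def flip: partial_mult_pow_1)
  with Suc show ?case
    by (simp add: times_diffop.rep_eq diffop_partial.rep_eq)
qed (simp add: one_diffop.rep_eq monom_0 one_pCons)

lemma diffop_coeff_monomial:
  "diffop_coeff (diffop_const a * \<partial> ^ k) i = (if i = k then a else 0)"
  by (simp add: diffop_coeff.rep_eq times_diffop.rep_eq diffop_const.rep_eq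
        poly_of_diffop_partial_power skew_mult_def smult_monom)

lemma diffop_expansion:
  "L = (\<Sum>k\<le>diffop_order L. diffop_const (diffop_coeff L k) * \<partial> ^ k)"
proof (rule diffop_eqI)
  fix i
  have "diffop_coeff L i = 0" if "i > diffop_order L"
    using that by transfer (rule coeff_eq_0)
  then show "diffop_coeff L i =
      diffop_coeff (\<Sum>k\<le>diffop_order L. diffop_const (diffop_coeff L k) * \<partial> ^ k) i"
    by (simp add: diffop_coeff_sum diffop_coeff_monomial not_le)
qed

lemma diffop_coeff_order: "L \<noteq> 0 \<Longrightarrow> diffop_coeff L (diffop_order L) \<noteq> 0"
  by transfer simp

text \<open>
  The three notions below are meant for operators \<open>L\<close> with \<open>diffop_coeff L 0 \<noteq> 0\<close>; in particular
  \<open>L \<noteq> 0\<close>, so that the junk value \<open>diffop_order 0 = 0\<close> plays no role.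
\<close>

definition num_coeffs :: "'a::differential_field diffop \<Rightarrow> nat" where
  "num_coeffs L = diffop_order L + 1"

definition reversing :: "'a::differential_field diffop \<Rightarrow> 'a diffop" where
  "reversing L = (\<Sum>k\<le>diffop_order L.
     diffop_const (diffop_coeff L k) * \<partial> ^ (diffop_order L - k))"

definition pasting :: "'a::differential_field diffop \<Rightarrow> 'a diffop \<Rightarrow> 'a diffop"
    (infixl \<open>\<diamondop>\<close> 65) where
  "L \<diamondop> R = L * \<partial> ^ num_coeffs R + R"

end

theory Submission
  imports Defs
begin

text \<open>Regard an operator as its list of coefficients, lowest order first. Right multiplication
  by a power of \<open>\<partial>\<close> differentiates nothing and only shifts this list, so
  \<open>L \<diamondop> R\<close> is the list of \<open>R\<close> followed by that of
  \<open>L\<close> (\<open>diffop_coeff_pasting\<close>), while \<open>reversing\<close> reverses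
  the list. The first claim is thus the rule for reversing a concatenation, the second its
  associativity. Nonvanishing coefficients at the ends keep the list lengths, i.e. the orders, as
  expected.\<close>

text \<open>The coefficient 1 is killed by \<open>der\<close>, so no derivative terms arise and the
  skew product collapses to the commutative one.\<close>

lemma skew_mult_monom_1_right: "skew_mult p (monom 1 m) = p * monom 1 m"
proof -
  have "(partial_mult ^^ i) (monom 1 m :: 'a poly) = monom 1 (i + m)" for i
    unfolding partial_mult_pow_1 [symmetric] by (simp add: funpow_add)
  then have "skew_mult p (monom 1 m) = (\<Sum>i\<le>degree p. monom (coeff p i) i) * monom 1 m"
    by (simp add: skew_mult_def smult_monom sum_distrib_right mult_monom)
  then show ?thesis
    by (simp add: poly_as_sum_of_monoms)
qed

lemma diffop_coeff_mult_partial_power: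
  "diffop_coeff (L * \<partial> ^ m) i = (if i < m then 0 else diffop_coeff L (i - m))"
  by (simp add: diffop_coeff.rep_eq times_diffop.rep_eq poly_of_diffop_partial_power
      skew_mult_monom_1_right mult.commute [of _ "monom 1 m"] coeff_monom_mult)

lemma diffop_coeff_eq_0: "diffop_order L < i \<Longrightarrow> diffop_coeff L i = 0"
  by transfer (rule coeff_eq_0)

lemma diffop_order_eqI:
  assumes "diffop_coeff L n \<noteq> 0" and "\<And>i. n < i \<Longrightarrow> diffop_coeff L i = 0"
  shows "diffop_order L = n"
  using assms by transfer (meson antisym degree_le le_degree)

lemma diffop_coeff_pasting:
  "diffop_coeff (L \<diamondop> R) i =
    (if i \<le> diffop_order R then diffop_coeff R i else diffop_coeff L (i - Suc (diffop_order R)))"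
  by (auto simp: pasting_def num_coeffs_def diffop_coeff_mult_partial_power diffop_coeff_eq_0
      simp del: power_Suc)

lemma diffop_order_pasting:
  assumes "L \<noteq> 0"
  shows "diffop_order (L \<diamondop> R) = diffop_order L + diffop_order R + 1"
  by (rule diffop_order_eqI)
     (use assms in \<open>auto simp: diffop_coeff_pasting diffop_coeff_order diffop_coeff_eq_0\<close>)

lemma diffop_coeff_reversing:
  "diffop_coeff (reversing L) i =
    (if i \<le> diffop_order L then diffop_coeff L (diffop_order L - i) else 0)"
proof -
  have "diffop_coeff (reversing L) i =
      (\<Sum>k\<le>diffop_order L. if i = diffop_order L - k then diffop_coeff L k else 0)"
    by (simp add: reversing_def diffop_coeff_sum diffop_coeff_monomial)
  \<comment> \<open>Solving for \<open>k\<close> isolates a single summand; the bound on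
    \<open>i\<close> must be added because truncated subtraction would otherwise give
    \<open>k = 0\<close> for large \<open>i\<close>.\<close>
  also have "\<dots> = (\<Sum>k\<le>diffop_order L. if k = diffop_order L - i \<and> i \<le> diffop_order L
      then diffop_coeff L k else 0)"
    by (rule sum.cong) auto
  also have "\<dots> = (if i \<le> diffop_order L then diffop_coeff L (diffop_order L - i) else 0)"
    by simp
  finally show ?thesis .
qed

text \<open>The order-zero coefficient of \<open>L\<close> becomes the leading one, so the order
  cannot drop.\<close>

lemma diffop_order_reversing:
  assumes "diffop_coeff L 0 \<noteq> 0"
  shows "diffop_order (reversing L) = diffop_order L"
  by (rule diffop_order_eqI) (use assms in \<open>auto simp: diffop_coeff_reversing\<close>)

lemma reversing_pasting:
  assumes "diffop_coeff R 0 \<noteq> 0"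
  shows "reversing L \<diamondop> reversing R = reversing (R \<diamondop> L)"
proof (rule diffop_eqI)
  fix i
  have "R \<noteq> 0"
    using assms by auto
  then show "diffop_coeff (reversing L \<diamondop> reversing R) i = diffop_coeff (reversing (R \<diamondop> L)) i"
    \<comment> \<open>Both sides switch from \<open>R\<close> to \<open>L\<close> just after index
      \<open>diffop_order R\<close>; only equalities between index expressions remain.\<close>
    by (auto simp: diffop_coeff_pasting diffop_coeff_reversing diffop_order_reversing [OF assms]
        diffop_order_pasting intro!: arg_cong [of _ _ "diffop_coeff _"])
qed

text \<open>As \<open>num_coeffs\<close> is additive on \<open>R \<diamondop> S\<close>, both sides
  expand to the same sum by distributivity.\<close>

lemma pasting_assoc:
  assumes "R \<noteq> 0"
  shows "(L \<diamondop> R) \<diamondop> S = L \<diamondop> (R \<diamondop> S)"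
proof -
  have "num_coeffs (R \<diamondop> S) = num_coeffs R + num_coeffs S"
    using assms by (simp add: num_coeffs_def diffop_order_pasting)
  then show ?thesis
    by (simp add: pasting_def [of _ S] pasting_def [of L] power_add algebra_simps)
qed

theorem proposition3p9:
  fixes L R S :: "'a::differential_field diffop"
  assumes "diffop_coeff L 0 \<noteq> 0"
    and "diffop_coeff R 0 \<noteq> 0"
    and "diffop_coeff S 0 \<noteq> 0"
  shows "reversing L \<diamondop> reversing R = reversing (R \<diamondop> L)
    \<and> (L \<diamondop> R) \<diamondop> S = L \<diamondop> (R \<diamondop> S)"
proof -
  have "R \<noteq> 0"
    using assms(2) by auto
  with assms(2) show ?thesis
    by (simp add: reversing_pasting pasting_assoc)
qed

end
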